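(* Let $V\ge1$ and let $p(s)=(p_{(1)}(s),\dots,p_{(V)}(s))$ with $p_{(1)}(s)\ge p_{(2)}(s)\ge\cdots\ge p_{(V)}(s)$ be the frozen-model next-token probabilities at a context $s$, sorted in decreasing order (a probability vector). Let $\alpha=1/\tau>0$, $k\in\{1,\dots,V\}$ and $\text{top-}p\in(0,1]$. For any fixed permutation $\sigma$ of the three operators $\mathcal{T}_\alpha$ (temperature scaling), $\mathcal{K}_k$ (top-$k$ truncation) and $\mathcal{P}_{\text{top-}p}$ (top-$p$ truncation), let $\mu^\sigma_s$ be the distribution obtained by applying the three operators to $p(s)$ in the order $\sigma$. Then there is a prefix length $m^\sigma_s\in\{1,\dots,V\}$, depending on the order $\sigma$, the parameters $(\alpha,k,\text{top-}p)$ and the context $s$, such that for every rank $i$ $$\mu^\sigma_s((i))=\frac{p_{(i)}(s)^\alpha\,\mathbf{1}[i\le m^\sigma_s]}{\sum_{j=1}^{m^\sigma_s}p_{(j)}(s)^\alpha}.$$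
   Context: Here $(i)$ denotes the token of rank $i$ under the frozen model at context $s$. The operators act on probability vectors $p$ indexed by these ranks with $p_{(1)}\ge\cdots\ge p_{(V)}$: Temperature scaling: $(\mathcal{T}_\alpha p)_{(i)}=\dfrac{p_{(i)}^\alpha}{\sum_{j=1}^V p_{(j)}^\alpha}$ (with $0^\alpha=0$). Top-$k$ truncation: $(\mathcal{K}_k p)_{(i)}=\dfrac{p_{(i)}\mathbf{1}[i\le k]}{\sum_{j=1}^k p_{(j)}}$. Top-$p$ truncation: with $m_{\text{top-}p}(p)=\min\{m:\sum_{i=1}^m p_{(i)}\ge\text{top-}p\}$, $(\mathcal{P}_{\text{top-}p}p)_{(i)}=\dfrac{p_{(i)}\mathbf{1}[i\le m_{\text{top-}p}(p)]}{\sum_{j=1}^{m_{\text{top-}p}(p)}p_{(j)}}$. $\tau>0$ is the evaluation-time temperature. *)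

theory Defs
  imports Complex_Main "HOL-Combinatorics.Multiset_Permutations"
begin

text \<open>
  A vector over a vocabulary of size \<open>V\<close> is a function \<open>nat \<Rightarrow> real\<close> of the rank; only its
  values on the ranks \<open>{1..V}\<close> are meaningful.
\<close>

definition sorted_prob_vector :: "nat \<Rightarrow> (nat \<Rightarrow> real) \<Rightarrow> bool" where
  "sorted_prob_vector V p \<longleftrightarrow>
     (\<forall>i\<in>{1..V}. 0 \<le> p i) \<and> (\<Sum>i=1..V. p i) = 1 \<and> antimono_on {1..V} p"

text \<open>The convention \<open>0\<^sup>\<alpha> = 0\<close> is built into \<open>powr\<close>.\<close>

definition temperature_scaling :: "nat \<Rightarrow> real \<Rightarrow> (nat \<Rightarrow> real) \<Rightarrow> nat \<Rightarrow> real" where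
  "temperature_scaling V \<alpha> p i = p i powr \<alpha> / (\<Sum>j=1..V. p j powr \<alpha>)"

definition top_k_truncation :: "nat \<Rightarrow> (nat \<Rightarrow> real) \<Rightarrow> nat \<Rightarrow> real" where
  "top_k_truncation k p i = p i * of_bool (i \<le> k) / (\<Sum>j=1..k. p j)"

text \<open>
  The set under the minimum is nonempty whenever \<open>p\<close> sums to 1 over \<open>{1..V}\<close> and the
  threshold \<open>q\<close> is at most 1.
\<close>

definition top_p_cutoff :: "nat \<Rightarrow> real \<Rightarrow> (nat \<Rightarrow> real) \<Rightarrow> nat" where
  "top_p_cutoff V q p = Min {m \<in> {1..V}. (\<Sum>i=1..m. p i) \<ge> q}"

definition top_p_truncation :: "nat \<Rightarrow> real \<Rightarrow> (nat \<Rightarrow> real) \<Rightarrow> nat \<Rightarrow> real" where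
  "top_p_truncation V q p i =
     p i * of_bool (i \<le> top_p_cutoff V q p) / (\<Sum>j=1..top_p_cutoff V q p. p j)"

text \<open>
  Orders are lists of operator names rather than of operators, since for some parameters
  two of the operators coincide as functions.
\<close>

datatype sampling_op = Temperature | Top_K | Top_P

fun apply_op :: "nat \<Rightarrow> real \<Rightarrow> nat \<Rightarrow> real \<Rightarrow> sampling_op \<Rightarrow> (nat \<Rightarrow> real) \<Rightarrow> nat \<Rightarrow> real" where
  "apply_op V \<alpha> k q Temperature = temperature_scaling V \<alpha>"
| "apply_op V \<alpha> k q Top_K = top_k_truncation k"
| "apply_op V \<alpha> k q Top_P = top_p_truncation V q"

text \<open>The head of \<open>\<sigma>\<close> is applied first.\<close>

definition sampling_distribution ::
  "nat \<Rightarrow> real \<Rightarrow> nat \<Rightarrow> real \<Rightarrow> sampling_op list \<Rightarrow> (nat \<Rightarrow> real) \<Rightarrow> nat \<Rightarrow> real" where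
  "sampling_distribution V \<alpha> k q \<sigma> p = fold (apply_op V \<alpha> k q) \<sigma> p"

end

theory Submission
  imports Defs
begin

text \<open>
  Normalising constants cancel, so each operator maps a normalised prefix of a weight vector to
  a normalised prefix: truncation shortens the prefix, and temperature scaling raises the weights
  to the power \<open>\<alpha>\<close>. Temperature scaling occurs exactly once in the order.
\<close>

definition prefix_distribution :: "(nat \<Rightarrow> real) \<Rightarrow> nat \<Rightarrow> nat \<Rightarrow> real" where
  "prefix_distribution w m i = w i * of_bool (i \<le> m) / (\<Sum>j=1..m. w j)"

lemma sum_of_bool_prefix:
  fixes w :: "nat \<Rightarrow> real"
  shows "(\<Sum>j=1..c. w j * of_bool (j \<le> m)) = (\<Sum>j=1..min m c. w j)"
  by (rule sum.mono_neutral_cong_right) auto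

lemma sum_prefix_distribution:
  "(\<Sum>j=1..c. prefix_distribution w m j) = (\<Sum>j=1..min m c. w j) / (\<Sum>j=1..m. w j)"
  by (simp only: prefix_distribution_def sum_divide_distrib[symmetric] sum_of_bool_prefix)

text \<open>Weights at later ranks may vanish, so positivity of each prefix sum, needed to cancel
  normalising constants, rests on the first weight alone.\<close>

lemma sum_pos_if_first_pos:
  fixes w :: "nat \<Rightarrow> real"
  assumes "\<And>i. i \<in> {1..V} \<Longrightarrow> 0 \<le> w i" "0 < w 1" "m \<in> {1..V}"
  shows "0 < (\<Sum>j=1..m. w j)"
  by (rule sum_pos2[of _ 1]) (use assms in auto)

text \<open>The prefix sum of \<open>w\<close> up to \<open>m\<close> divides both the entries of
  \<open>r\<close> and their partial sums, hence cancels. The cutoff \<open>c\<close> is arbitrary,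
  so this serves top-k and top-p alike.\<close>

lemma truncate_prefix_distribution:
  assumes "\<And>i. i \<in> {1..V} \<Longrightarrow> r i = prefix_distribution w m i"
    and "(\<Sum>j=1..m. w j) \<noteq> 0" and "c \<in> {1..V}" and "i \<in> {1..V}"
  shows "r i * of_bool (i \<le> c) / (\<Sum>j=1..c. r j) = prefix_distribution w (min m c) i"
proof -
  have "(\<Sum>j=1..c. r j) = (\<Sum>j=1..c. prefix_distribution w m j)"
    using assms by (intro sum.cong) auto
  also have "\<dots> = (\<Sum>j=1..min m c. w j) / (\<Sum>j=1..m. w j)"
    by (rule sum_prefix_distribution)
  finally have "(\<Sum>j=1..c. r j) = (\<Sum>j=1..min m c. w j) / (\<Sum>j=1..m. w j)" .
  then show ?thesis
    using assms(2) assms(1)[OF assms(4)] by (simp add: prefix_distribution_def)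
qed

lemma temperature_scaling_prefix_distribution:
  assumes r: "\<And>i. i \<in> {1..V} \<Longrightarrow> r i = prefix_distribution w m i"
    and w: "\<And>i. i \<in> {1..V} \<Longrightarrow> 0 \<le> w i" "0 < w 1"
    and m: "m \<in> {1..V}" and i: "i \<in> {1..V}"
  shows "temperature_scaling V \<alpha> r i = prefix_distribution (\<lambda>i. w i powr \<alpha>) m i"
proof -
  let ?S = "\<Sum>j=1..m. w j"
  have S: "0 < ?S"
    using w m by (rule sum_pos_if_first_pos)
  \<comment> \<open>Beyond \<open>m\<close> the entry is 0 and \<open>0 powr \<alpha> = 0\<close>,
    so the indicator survives the power; the factor \<open>?S powr \<alpha>\<close> is common to all
    ranks.\<close>
  have powr: "r j powr \<alpha> = w j powr \<alpha> * of_bool (j \<le> m) / ?S powr \<alpha>" if "j \<in> {1..V}" for j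
    using r[OF that] w(1)[OF that] S by (simp add: prefix_distribution_def powr_divide)
  have "(\<Sum>j=1..V. r j powr \<alpha>) = (\<Sum>j=1..V. w j powr \<alpha> * of_bool (j \<le> m)) / ?S powr \<alpha>"
    unfolding sum_divide_distrib by (intro sum.cong refl powr)
  also have "\<dots> = (\<Sum>j=1..m. w j powr \<alpha>) / ?S powr \<alpha>"
    using m by (simp only: sum_of_bool_prefix) (simp add: min_absorb1)
  finally show ?thesis
    using S powr[OF i] by (simp add: temperature_scaling_def prefix_distribution_def)
qed

lemma top_p_cutoff_in_range:
  assumes "V \<ge> 1" "q \<le> (\<Sum>i=1..V. r i)"
  shows "top_p_cutoff V q r \<in> {1..V}"
proof -
  let ?A = "{m \<in> {1..V}. (\<Sum>i=1..m. r i) \<ge> q}"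
  have "V \<in> ?A"
    using assms by simp
  then have "Min ?A \<in> ?A"
    by (intro Min_in) auto
  then show ?thesis
    by (simp add: top_p_cutoff_def)
qed

text \<open>Tails of a permutation are no longer permutations of the full set, so the induction runs
  over arbitrary operator lists, with the exponent recording how often temperature has
  acted.\<close>

lemma fold_apply_op_prefix_distribution:
  assumes "\<And>i. i \<in> {1..V} \<Longrightarrow> r i = prefix_distribution w m i"
    and "\<And>i. i \<in> {1..V} \<Longrightarrow> 0 \<le> w i" "0 < w 1"
    and "m \<in> {1..V}" and k: "k \<in> {1..V}" and q: "q \<le> 1"
  shows "\<exists>m'\<in>{1..V}. \<forall>i\<in>{1..V}. fold (apply_op V \<alpha> k q) \<sigma> r i =
           prefix_distribution (\<lambda>i. w i powr \<alpha> ^ count_list \<sigma> Temperature) m' i"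
  using assms(1-4)
proof (induction \<sigma> arbitrary: r w m)
  case Nil
  \<comment> \<open>For the empty list the exponent is \<open>\<alpha> ^ 0 = 1\<close>;
    \<open>x powr 1 = x\<close> relies on nonnegative weights.\<close>
  have "prefix_distribution (\<lambda>i. w i powr 1) m i = prefix_distribution w m i"
    if "i \<in> {1..V}" for i
  proof -
    have "(\<Sum>j=1..m. w j powr 1) = (\<Sum>j=1..m. w j)"
      using Nil.prems by (intro sum.cong) auto
    then show ?thesis
      using Nil.prems(2)[OF that] by (simp add: prefix_distribution_def)
  qed
  then show ?case
    using Nil.prems by (intro bexI[of _ m]) auto
next
  case (Cons op \<sigma>)
  have S: "0 < (\<Sum>j=1..m. w j)"
    using Cons.prems(2-4) by (rule sum_pos_if_first_pos)
  \<comment> \<open>Shared by both truncations: the weights stay fixed and the prefix shrinks to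
    \<open>min m c\<close>, where \<open>c\<close> may depend on \<open>r\<close>.\<close>
  have truncation: ?case
    if "op \<noteq> Temperature" and c: "c \<in> {1..V}"
      and op: "\<And>i. apply_op V \<alpha> k q op r i = r i * of_bool (i \<le> c) / (\<Sum>j=1..c. r j)" for c
  proof -
    have "apply_op V \<alpha> k q op r i = prefix_distribution w (min m c) i" if "i \<in> {1..V}" for i
      using truncate_prefix_distribution[OF Cons.prems(1) less_imp_neq[OF S, symmetric] c that]
      by (simp only: op)
    from Cons.IH[OF this] show ?thesis
      using Cons.prems that(1,2) by auto
  qed
  show ?case
  proof (cases op)
    case Temperature
    have "apply_op V \<alpha> k q op r i = prefix_distribution (\<lambda>i. w i powr \<alpha>) m i"
      if "i \<in> {1..V}" for i
      using temperature_scaling_prefix_distribution[OF Cons.prems that] Temperature by simp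
    \<comment> \<open>The new weights are \<open>w i powr \<alpha>\<close>, and the exponents
      multiply: \<open>\<alpha> * \<alpha> ^ n = \<alpha> ^ Suc n\<close>.\<close>
    from Cons.IH[OF this] show ?thesis
      using Cons.prems Temperature by (auto simp: powr_powr)
  next
    case Top_K
    then show ?thesis
      using k by (intro truncation[of k]) (auto simp: top_k_truncation_def)
  next
    case Top_P
    \<comment> \<open>Every intermediate vector still has total mass 1, so the threshold
      \<open>q\<close> is reached within \<open>V\<close> ranks.\<close>
    have "(\<Sum>i=1..V. r i) = (\<Sum>i=1..V. prefix_distribution w m i)"
      using Cons.prems(1) by (intro sum.cong) auto
    also have "\<dots> = 1"
      using S Cons.prems(4) by (simp only: sum_prefix_distribution) (simp add: min_absorb1)
    finally have "top_p_cutoff V q r \<in> {1..V}"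
      using q Cons.prems(4) by (intro top_p_cutoff_in_range) auto
    with Top_P show ?thesis
      by (intro truncation[of "top_p_cutoff V q r"]) (auto simp: top_p_truncation_def)
  qed
qed

text \<open>The first entry is the largest; were it not positive, the total could not be 1.\<close>

lemma sorted_prob_vector_first_pos:
  assumes "sorted_prob_vector V p"
  shows "0 < p 1"
proof (rule ccontr)
  assume "\<not> 0 < p 1"
  moreover have "p i \<le> p 1" if "i \<in> {1..V}" for i
    using assms that by (auto simp: sorted_prob_vector_def monotone_on_def)
  ultimately have "(\<Sum>i=1..V. p i) \<le> 0"
    by (intro sum_nonpos) force
  then show False
    using assms by (simp add: sorted_prob_vector_def)
qed

theorem propositionB5:
  fixes V k :: nat and \<tau> \<alpha> top_p :: real
    and p :: "'s \<Rightarrow> nat \<Rightarrow> real" and s :: 's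
    and \<sigma> :: "sampling_op list"
  assumes "V \<ge> 1"
    and "sorted_prob_vector V (p s)"
    and "\<tau> > 0" and "\<alpha> = 1 / \<tau>"
    and "k \<in> {1..V}"
    and "top_p \<in> {0<..1}"
    and "\<sigma> \<in> permutations_of_set {Temperature, Top_K, Top_P}"
  shows "\<exists>m\<in>{1..V}. \<forall>i\<in>{1..V}.
           sampling_distribution V \<alpha> k top_p \<sigma> (p s) i =
             p s i powr \<alpha> * of_bool (i \<le> m) / (\<Sum>j=1..m. p s j powr \<alpha>)"
proof -
  \<comment> \<open>The induction starts from the full prefix \<open>m = V\<close>, whose
    normalising constant is 1.\<close>
  have "p s i = prefix_distribution (p s) V i" if "i \<in> {1..V}" for i
    using assms(2) that by (simp add: prefix_distribution_def sorted_prob_vector_def)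
  moreover have "0 \<le> p s i" if "i \<in> {1..V}" for i
    using assms(2) that by (simp add: sorted_prob_vector_def)
  ultimately have "\<exists>m\<in>{1..V}. \<forall>i\<in>{1..V}. fold (apply_op V \<alpha> k top_p) \<sigma> (p s) i =
      prefix_distribution (\<lambda>i. p s i powr \<alpha> ^ count_list \<sigma> Temperature) m i"
    using assms sorted_prob_vector_first_pos[OF assms(2)]
    by (intro fold_apply_op_prefix_distribution[where m = V]) auto
  moreover have "count_list \<sigma> Temperature = 1"
    using assms(7) by (simp add: permutations_of_set_def distinct_count_atmost_1 flip: count_mset)
  ultimately show ?thesis
    by (simp add: sampling_distribution_def prefix_distribution_def)
qed

end
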